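(* Let $A$ be a nonempty subset of $\mathbb R$ and $f: A \rightarrow \mathbb R$. If $f$ is uniformly continuous on $A$, then $f$ is uniformly symmetrically continuous on $A$.
   Context: Let $A$ be a nonempty subset of $\mathbb R$ and $f:A\to\mathbb R$. The function $f$ is uniformly symmetrically continuous on $A$ if for every $\varepsilon>0$ there exists $\delta>0$ such that $|f(a+h)-f(a-h)|<\varepsilon$ for all $h\in\mathbb R$ and $a\in A$ satisfying $|h|<\delta$, $a+h\in A$ and $a-h\in A$. *)

theory Defs
  imports Complex_Main
begin

(* A function A -> R is represented by a total function on the reals; only its values on A
   are used, since f is evaluated only at points a + h and a - h that lie in A. *)
definition uniformly_symmetrically_continuous_on ::
  "real set \<Rightarrow> (real \<Rightarrow> real) \<Rightarrow> bool" where
  "uniformly_symmetrically_continuous_on A f \<longleftrightarrow>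
     (\<forall>\<epsilon>>0. \<exists>\<delta>>0. \<forall>h. \<forall>a\<in>A.
        \<bar>h\<bar> < \<delta> \<longrightarrow> a + h \<in> A \<longrightarrow> a - h \<in> A \<longrightarrow>
        \<bar>f (a + h) - f (a - h)\<bar> < \<epsilon>)"

end

theory Submission
  imports Defs
begin

text \<open>The points \<open>a + h\<close> and \<open>a - h\<close> both lie in \<open>A\<close>,
  and their distance is 2|h|. Uniform continuity compares any two points of \<open>A\<close> that
  are close enough, so it applies to this pair directly: if \<open>d\<close> serves for \<epsilon>
  there, then \<open>d / 2\<close> serves as the bound on |h| here.\<close>

theorem theorem2p1:
  fixes A :: "real set" and f :: "real \<Rightarrow> real"
  assumes "A \<noteq> {}"
    and "uniformly_continuous_on A f"
  shows "uniformly_symmetrically_continuous_on A f"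
  unfolding uniformly_symmetrically_continuous_on_def
proof (intro allI impI)
  fix \<epsilon> :: real
  assume "\<epsilon> > 0"
  then obtain d where "d > 0"
    and d: "\<And>x y. x \<in> A \<Longrightarrow> y \<in> A \<Longrightarrow> dist y x < d \<Longrightarrow> dist (f y) (f x) < \<epsilon>"
    using assms(2) unfolding uniformly_continuous_on_def by meson
  have "\<bar>f (a + h) - f (a - h)\<bar> < \<epsilon>"
    if "\<bar>h\<bar> < d / 2" "a + h \<in> A" "a - h \<in> A" for a h
    \<comment> \<open>The halving enters here: \<open>dist (a + h) (a - h)\<close> = |2h| <
      \<open>d\<close>. Taking \<open>a - h\<close> as \<open>x\<close> and \<open>a + h\<close> as
      \<open>y\<close> yields the difference of values in the order of the goal.\<close>
    using d[of "a - h" "a + h"] that by (simp add: dist_real_def)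
  with \<open>d > 0\<close> show "\<exists>\<delta>>0. \<forall>h. \<forall>a\<in>A. \<bar>h\<bar> < \<delta> \<longrightarrow> a + h \<in> A \<longrightarrow> a - h \<in> A \<longrightarrow>
      \<bar>f (a + h) - f (a - h)\<bar> < \<epsilon>"
    by (intro exI[of _ "d / 2"]) auto
qed

end
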